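(* Let $n\ge 1$. If $k=1$ then $\mathfrak{WD}_{n,1}(x)=D_n(x)$. If $2\le k\le n$, writing $n=dk+r$ with integers $d\ge 0$, $0\le r<k$, then $$\mathfrak{WD}_{n,k}(x):=\sum_{\pi\in D_n}x^{\mathrm{des}_k^D(\pi)}=2^{n-d-1}M_{n,k}\,B_d(x)\,A_d(x)^{k-r-1}A_{d+1}(x)^r.$$
   Context: $B_n$ is the set of signed permutations of $[n]$: bijections $\pi$ of $\{\pm1,\dots,\pm n\}$ with $\pi(-i)=-\pi(i)$, written $\pi=(\pi(1),\dots,\pi(n))$; set $\pi(0)=0$. $D_n=\{\pi\in B_n:\ |\{i\in[n]:\pi(i)<0\}|\text{ is even}\}$. For $\pi\in B_n$ (in particular $\pi\in D_n$), $\mathrm{des}_k^D(\pi)=\mathrm{des}_k^B(\pi)=|\{0\le i\le n-k:\pi(i)>\pi(i+k)\}|$; $\mathrm{des}^B=\mathrm{des}_1^B$ and $\mathrm{des}^A(\sigma)=|\{i\in[m-1]:\sigma(i)>\sigma(i+1)\}|$. $D_n(x)=\sum_{\pi\in D_n}x^{\mathrm{des}^B(\pi)}$ (the type $D$ Eulerian polynomial in the sense of Borowiec–Młotkowski). $A_m(x)=\sum_{\sigma\in\mathfrak{S}_m}x^{\mathrm{des}^A(\sigma)}$, $B_m(x)=\sum_{\pi\in B_m}x^{\mathrm{des}^B(\pi)}$. $M_{n,k}=\dfrac{n!}{((d+1)!)^r(d!)^{k-r}}$. *)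

theory Defs
  imports "HOL-Combinatorics.Permutations" "HOL-Computational_Algebra.Polynomial"
begin

text \<open>Since \<^term>\<open>p permutes S\<close> makes \<open>p\<close> the identity outside \<open>S\<close>, the convention
  \<open>\<pi>(0) = 0\<close> for signed permutations is built in.\<close>

definition signed_perms :: "nat \<Rightarrow> (int \<Rightarrow> int) set" where
  "signed_perms n =
     {\<pi>. \<pi> permutes ({- int n..int n} - {0}) \<and>
         (\<forall>i \<in> {- int n..int n} - {0}. \<pi> (- i) = - \<pi> i)}"

definition even_signed_perms :: "nat \<Rightarrow> (int \<Rightarrow> int) set" where
  "even_signed_perms n =
     {\<pi> \<in> signed_perms n. even (card {i \<in> {1..int n}. \<pi> i < 0})}"

lemma finite_signed_perms: "finite (signed_perms n)"
  unfolding signed_perms_def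
  by (rule finite_subset[OF _ finite_permutations[of "{- int n..int n} - {0}"]]) auto

lemma finite_even_signed_perms: "finite (even_signed_perms n)"
  unfolding even_signed_perms_def using finite_signed_perms by simp

definition des_A :: "nat \<Rightarrow> (nat \<Rightarrow> nat) \<Rightarrow> nat" where
  "des_A m \<sigma> = card {i \<in> {1..<m}. \<sigma> i > \<sigma> (i + 1)}"

definition des_B :: "nat \<Rightarrow> nat \<Rightarrow> (int \<Rightarrow> int) \<Rightarrow> nat" where
  "des_B n k \<pi> = card {i \<in> {0..int n - int k}. \<pi> i > \<pi> (i + int k)}"

definition des_D :: "nat \<Rightarrow> nat \<Rightarrow> (int \<Rightarrow> int) \<Rightarrow> nat" where
  "des_D n k \<pi> = des_B n k \<pi>"

text \<open>The polynomials are taken over the rationals so that the quotient \<open>multi_coeff\<close> below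
  is an exact division.\<close>

definition eulerian_A :: "nat \<Rightarrow> rat poly" where
  "eulerian_A m = (\<Sum>\<sigma> | \<sigma> permutes {1..m}. monom 1 (des_A m \<sigma>))"

definition eulerian_B :: "nat \<Rightarrow> rat poly" where
  "eulerian_B m = (\<Sum>\<pi>\<in>signed_perms m. monom 1 (des_B m 1 \<pi>))"

definition eulerian_D :: "nat \<Rightarrow> rat poly" where
  "eulerian_D n = (\<Sum>\<pi>\<in>even_signed_perms n. monom 1 (des_B n 1 \<pi>))"

definition WD :: "nat \<Rightarrow> nat \<Rightarrow> rat poly" where
  "WD n k = (\<Sum>\<pi>\<in>even_signed_perms n. monom 1 (des_D n k \<pi>))"

definition multi_coeff :: "nat \<Rightarrow> nat \<Rightarrow> rat" where
  "multi_coeff n k =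
     (let d = n div k; r = n mod k
      in fact n / (fact (d + 1) ^ r * fact d ^ (k - r)))"

end

theory Submission
  imports Defs
begin

text \<open>The residue classes modulo \<open>k\<close> of the positions do not interact in \<open>des\<^sub>k\<close>. Hence, summing
  \<open>s ^ neg(\<pi>) x ^ des\<^sub>k(\<pi>)\<close> over all signed permutations, one may first distribute the absolute
  values over the classes (a multinomial coefficient) and then fill each class separately. The
  class of \<open>0\<close> is prefixed by \<open>\<pi>(0) = 0\<close> and contributes a type B polynomial; any other class with
  \<open>m\<close> elements contributes \<open>(1 + s) ^ m\<close> for the choice of the signs times \<open>A\<^sub>m\<close>. The sum over
  \<open>D\<^sub>n\<close> is half the sum of the values at \<open>s = 1\<close> and \<open>s = -1\<close>, and the latter vanishes because
  for \<open>2 \<le> k \<le> n\<close> there is a nonempty class other than that of \<open>0\<close>.\<close>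

section \<open>Signed arrangements\<close>

definition zero_ext :: "'a set \<Rightarrow> ('a \<Rightarrow> int) \<Rightarrow> 'a \<Rightarrow> int" where
  "zero_ext P f = (\<lambda>i. if i \<in> P then f i else 0)"

definition bijections :: "'a set \<Rightarrow> int set \<Rightarrow> ('a \<Rightarrow> int) set" where
  "bijections P U = {f. (\<forall>i. i \<notin> P \<longrightarrow> f i = 0) \<and> bij_betw f P U}"

text \<open>The value \<open>0\<close> outside \<open>P\<close> builds in the convention \<open>\<pi>(0) = 0\<close>, since \<open>0\<close> is never
  one of the positions in \<open>P\<close> below.\<close>

definition signed_arrs :: "'a set \<Rightarrow> int set \<Rightarrow> ('a \<Rightarrow> int) set" where
  "signed_arrs P V = {f. (\<forall>i. i \<notin> P \<longrightarrow> f i = 0) \<and> bij_betw (\<lambda>i. \<bar>f i\<bar>) P V}"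

definition neg_count :: "'a set \<Rightarrow> ('a \<Rightarrow> int) \<Rightarrow> nat" where
  "neg_count P f = card {i \<in> P. f i < 0}"

lemma zero_ext_apply [simp]: "i \<in> P \<Longrightarrow> zero_ext P f i = f i" "i \<notin> P \<Longrightarrow> zero_ext P f i = 0"
  by (simp_all add: zero_ext_def)

lemma zero_ext_zero_ext: "P \<subseteq> Q \<Longrightarrow> zero_ext P (zero_ext Q f) = zero_ext P f"
  by (auto simp: zero_ext_def fun_eq_iff)

lemma signed_arrs_outside: "f \<in> signed_arrs P V \<Longrightarrow> i \<notin> P \<Longrightarrow> f i = 0"
  by (simp add: signed_arrs_def)

lemma zero_ext_in_signed_arrs_iff:
  "zero_ext P f \<in> signed_arrs P V \<longleftrightarrow> bij_betw (\<lambda>i. \<bar>f i\<bar>) P V"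
proof -
  have "bij_betw (\<lambda>i. \<bar>zero_ext P f i\<bar>) P V \<longleftrightarrow> bij_betw (\<lambda>i. \<bar>f i\<bar>) P V"
    by (rule bij_betw_cong) simp
  then show ?thesis by (simp add: signed_arrs_def)
qed

lemma finite_bounded_zero_ext:
  assumes "finite P" "finite W"
  shows "finite {f :: 'a \<Rightarrow> int. (\<forall>i. i \<notin> P \<longrightarrow> f i = 0) \<and> f ` P \<subseteq> W}"
proof -
  have "{f :: 'a \<Rightarrow> int. (\<forall>i. i \<notin> P \<longrightarrow> f i = 0) \<and> f ` P \<subseteq> W} =
    {f. \<forall>i. (i \<in> P \<longrightarrow> f i \<in> W) \<and> (i \<notin> P \<longrightarrow> f i = 0)}" by auto
  then show ?thesis using finite_set_of_finite_funs[OF assms] by simp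
qed

lemma finite_signed_arrs:
  assumes "finite P" "finite V"
  shows "finite (signed_arrs P V)"
proof (rule finite_subset[OF _ finite_bounded_zero_ext[of P "V \<union> uminus ` V"]])
  show "signed_arrs P V \<subseteq> {f. (\<forall>i. i \<notin> P \<longrightarrow> f i = 0) \<and> f ` P \<subseteq> V \<union> uminus ` V}"
  proof
    fix f assume f: "f \<in> signed_arrs P V"
    have "f i \<in> V \<union> uminus ` V" if "i \<in> P" for i
    proof -
      have "\<bar>f i\<bar> \<in> V" using f that by (auto simp: signed_arrs_def bij_betw_def)
      then show ?thesis by (cases "f i \<ge> 0") (force simp: image_iff)+
    qed
    then show "f \<in> {f. (\<forall>i. i \<notin> P \<longrightarrow> f i = 0) \<and> f ` P \<subseteq> V \<union> uminus ` V}"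
      using f by (auto simp: signed_arrs_def)
  qed
qed (use assms in auto)

lemma finite_bijections: "finite P \<Longrightarrow> finite U \<Longrightarrow> finite (bijections P U)"
  by (rule finite_subset[OF _ finite_bounded_zero_ext[of P U]])
     (auto simp: bijections_def bij_betw_def)

section \<open>Transport of sums along bijections of positions and of values\<close>

text \<open>Precomposition with \<open>e\<close> is undone by precomposition with its inverse.
  \<open>zero_ext\<close> restores the default \<open>0\<close> outside the index set, where
  \<open>e\<close> and \<open>inv_into T e\<close> are arbitrary.\<close>

lemma sum_signed_arrs_reindex:
  assumes e: "bij_betw e T P"
  shows "(\<Sum>g\<in>signed_arrs P V. F (zero_ext T (g \<circ> e))) = (\<Sum>h\<in>signed_arrs T V. F h)"
proof (rule sum.reindex_bij_witness[where i = "\<lambda>h. zero_ext P (h \<circ> inv_into T e)"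
      and j = "\<lambda>g. zero_ext T (g \<circ> e)"])
  have e': "e t \<in> P" "inv_into T e (e t) = t" if "t \<in> T" for t
    using e that by (auto simp: bij_betw_def)
  have i': "inv_into T e p \<in> T" "e (inv_into T e p) = p" if "p \<in> P" for p
    using e that by (auto simp: bij_betw_def inv_into_into f_inv_into_f)
  fix g assume g: "g \<in> signed_arrs P V"
  show "zero_ext P (zero_ext T (g \<circ> e) \<circ> inv_into T e) = g"
    using g i' by (auto simp: fun_eq_iff zero_ext_def signed_arrs_def)
  have "bij_betw ((\<lambda>i. \<bar>g i\<bar>) \<circ> e) T V"
    using g e by (intro bij_betw_trans[of _ _ P]) (auto simp: signed_arrs_def)
  then show "zero_ext T (g \<circ> e) \<in> signed_arrs T V"
    by (simp add: zero_ext_in_signed_arrs_iff comp_def)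
next
  have e': "e t \<in> P" "inv_into T e (e t) = t" if "t \<in> T" for t
    using e that by (auto simp: bij_betw_def)
  fix h assume h: "h \<in> signed_arrs T V"
  show "zero_ext T (zero_ext P (h \<circ> inv_into T e) \<circ> e) = h"
    using h e' by (auto simp: fun_eq_iff zero_ext_def signed_arrs_def)
  have "bij_betw ((\<lambda>i. \<bar>h i\<bar>) \<circ> inv_into T e) P V"
    using h bij_betw_inv_into[OF e]
    by (intro bij_betw_trans[of _ _ T]) (auto simp: signed_arrs_def)
  then show "zero_ext P (h \<circ> inv_into T e) \<in> signed_arrs P V"
    by (simp add: zero_ext_in_signed_arrs_iff comp_def)
qed simp

text \<open>An odd map that is positive on \<open>V\<close> commutes with \<open>abs\<close> on the
  elements of \<open>V\<close> and their negatives, so composing with it turns arrangements of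
  \<open>V\<close> into arrangements of \<open>W\<close>. Applied to an increasing
  \<open>\<psi>\<close>, this exchanges a set of values for their ranks.\<close>

lemma sum_signed_arrs_relabel:
  fixes \<psi> :: "int \<Rightarrow> int"
  assumes odd: "\<And>x. \<psi> (- x) = - \<psi> x" and bij: "bij_betw \<psi> V W"
    and V: "V \<subseteq> {0<..}" and W: "W \<subseteq> {0<..}"
  shows "(\<Sum>f\<in>signed_arrs P V. F (\<psi> \<circ> f)) = (\<Sum>g\<in>signed_arrs P W. F g)"
proof -
  \<comment> \<open>The odd extension of the inverse of \<open>\<psi>\<close> on \<open>V\<close>.
    Since \<open>sgn 0 = 0\<close>, it keeps the default value \<open>0\<close> outside the
    positions.\<close>
  define \<chi> where "\<chi> y = sgn y * inv_into V \<psi> \<bar>y\<bar>" for y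
  have z: "\<psi> 0 = 0" using odd[of 0] by simp
  have \<psi>V: "\<psi> x \<in> W" "inv_into V \<psi> (\<psi> x) = x" if "x \<in> V" for x
    using bij that by (auto simp: bij_betw_def)
  have \<chi>W: "inv_into V \<psi> y \<in> V" "\<psi> (inv_into V \<psi> y) = y" if "y \<in> W" for y
    using bij that by (auto simp: bij_betw_def inv_into_into f_inv_into_f)
  have pos: "\<And>x. x \<in> V \<Longrightarrow> 0 < x" "\<And>x. x \<in> W \<Longrightarrow> 0 < x" using V W by auto
  have abs\<psi>: "\<bar>\<psi> x\<bar> = \<psi> \<bar>x\<bar>" "sgn (\<psi> x) = sgn x" if "\<bar>x\<bar> \<in> V" for x
    using pos(2)[OF \<psi>V(1)[OF that]] pos(1)[OF that] odd[of x]
    by (cases "x > 0"; simp add: sgn_if)+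
  have abs\<chi>: "\<bar>\<chi> y\<bar> = inv_into V \<psi> \<bar>y\<bar>" "sgn (\<chi> y) = sgn y" if "\<bar>y\<bar> \<in> W" for y
    using pos(1)[OF \<chi>W(1)[OF that]] pos(2)[OF that]
    by (auto simp: \<chi>_def abs_mult sgn_mult)
  have \<chi>\<psi>: "\<chi> (\<psi> x) = x" if "\<bar>x\<bar> \<in> V" for x
    using abs\<psi>[OF that] \<psi>V(2)[OF that] by (simp add: \<chi>_def sgn_mult_abs)
  have \<psi>\<chi>: "\<psi> (\<chi> y) = y" if "\<bar>y\<bar> \<in> W" for y
    using \<chi>W(2)[OF that] odd[of "inv_into V \<psi> \<bar>y\<bar>"] pos(2)[OF that]
    by (cases "y > 0") (auto simp: \<chi>_def)
  show ?thesis
  proof (rule sum.reindex_bij_witness[where i = "\<lambda>g. \<chi> \<circ> g" and j = "\<lambda>f. \<psi> \<circ> f"])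
    fix f assume f: "f \<in> signed_arrs P V"
    then have fV: "\<bar>f i\<bar> \<in> V" if "i \<in> P" for i
      using that by (auto simp: signed_arrs_def bij_betw_def)
    show "\<chi> \<circ> (\<psi> \<circ> f) = f"
    proof
      fix i show "(\<chi> \<circ> (\<psi> \<circ> f)) i = f i"
        using \<chi>\<psi>[OF fV] f by (cases "i \<in> P") (auto simp: signed_arrs_def z \<chi>_def)
    qed
    have "bij_betw (\<psi> \<circ> (\<lambda>i. \<bar>f i\<bar>)) P W"
      using f bij by (intro bij_betw_trans[of _ _ V]) (auto simp: signed_arrs_def)
    then have "bij_betw (\<lambda>i. \<bar>(\<psi> \<circ> f) i\<bar>) P W"
      by (rule iffD1[OF bij_betw_cong, rotated]) (simp add: abs\<psi> fV)
    then show "\<psi> \<circ> f \<in> signed_arrs P W" using f z by (simp add: signed_arrs_def)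
  next
    fix g assume g: "g \<in> signed_arrs P W"
    then have gW: "\<bar>g i\<bar> \<in> W" if "i \<in> P" for i
      using that by (auto simp: signed_arrs_def bij_betw_def)
    show "\<psi> \<circ> (\<chi> \<circ> g) = g"
    proof
      fix i show "(\<psi> \<circ> (\<chi> \<circ> g)) i = g i"
        using \<psi>\<chi>[OF gW] g by (cases "i \<in> P") (auto simp: signed_arrs_def z \<chi>_def)
    qed
    have "bij_betw (inv_into V \<psi> \<circ> (\<lambda>i. \<bar>g i\<bar>)) P V"
      using g bij_betw_inv_into[OF bij]
      by (intro bij_betw_trans[of _ _ W]) (auto simp: signed_arrs_def)
    then have "bij_betw (\<lambda>i. \<bar>(\<chi> \<circ> g) i\<bar>) P V"
      by (rule iffD1[OF bij_betw_cong, rotated]) (simp add: abs\<chi> gW)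
    then show "\<chi> \<circ> g \<in> signed_arrs P V" using g by (simp add: signed_arrs_def \<chi>_def)
  qed simp
qed

section \<open>Distribution of the absolute values over disjoint blocks\<close>

text \<open>An arrangement on two disjoint blocks amounts to the set \<open>U\<close> of absolute
  values used on \<open>P\<close> together with its two restrictions. For fixed \<open>U\<close> the
  restrictions are chosen independently, so the sum factors.\<close>

lemma sum_signed_arrs_Un:
  fixes u v :: "('a \<Rightarrow> int) \<Rightarrow> 'b::comm_ring_1"
  assumes PQ: "P \<inter> Q = {}" and fin: "finite P" "finite Q" "finite V"
  shows "(\<Sum>f\<in>signed_arrs (P \<union> Q) V. u (zero_ext P f) * v (zero_ext Q f)) =
    (\<Sum>U | U \<subseteq> V \<and> card U = card P.
       (\<Sum>g\<in>signed_arrs P U. u g) * (\<Sum>h\<in>signed_arrs Q (V - U). v h))" (is "?L = ?R")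
proof -
  let ?I = "{U. U \<subseteq> V \<and> card U = card P}"
  have finI: "finite ?I" using fin by simp
  have finV: "finite U" if "U \<in> ?I" for U using that fin finite_subset by blast
  have "?R = (\<Sum>U\<in>?I. \<Sum>(g,h)\<in>signed_arrs P U \<times> signed_arrs Q (V - U). u g * v h)"
    by (simp add: sum_product sum.cartesian_product)
  also have "\<dots> = (\<Sum>(U,g,h)\<in>(SIGMA U:?I. signed_arrs P U \<times> signed_arrs Q (V - U)). u g * v h)"
  proof (rule sum.Sigma[OF finI], rule ballI)
    fix U assume "U \<in> ?I"
    then show "finite (signed_arrs P U \<times> signed_arrs Q (V - U))"
      using fin finV by (intro finite_cartesian_product finite_signed_arrs) blast+
  qed
  \<comment> \<open>Gluing is pointwise addition: \<open>g\<close> and \<open>h\<close> are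
    \<open>0\<close> outside their own blocks, so at every position at most one summand is
    nonzero.\<close>
  also have "\<dots> = ?L"
  proof (rule sum.reindex_bij_witness[symmetric, where
        i = "\<lambda>(U,g,h). \<lambda>i. g i + h i" and
        j = "\<lambda>f. ((\<lambda>i. \<bar>f i\<bar>) ` P, zero_ext P f, zero_ext Q f)"])
    fix f assume f: "f \<in> signed_arrs (P \<union> Q) V"
    show "(case ((\<lambda>i. \<bar>f i\<bar>) ` P, zero_ext P f, zero_ext Q f) of (U, g, h) \<Rightarrow> \<lambda>i. g i + h i) = f"
      using f PQ by (auto simp: fun_eq_iff zero_ext_def signed_arrs_def)
    have inj: "inj_on (\<lambda>i. \<bar>f i\<bar>) (P \<union> Q)" and im: "(\<lambda>i. \<bar>f i\<bar>) ` (P \<union> Q) = V"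
      using f by (auto simp: signed_arrs_def bij_betw_def)
    have "(\<lambda>i. \<bar>f i\<bar>) ` P \<in> ?I"
      using im inj by (auto intro!: card_image intro: inj_on_subset)
    moreover have "zero_ext P f \<in> signed_arrs P ((\<lambda>i. \<bar>f i\<bar>) ` P)"
      unfolding zero_ext_in_signed_arrs_iff using inj by (auto simp: bij_betw_def intro: inj_on_subset)
    \<comment> \<open>Injectivity of the absolute values on the union leaves exactly the complement
      of the image of \<open>P\<close> for \<open>Q\<close>.\<close>
    moreover have "(\<lambda>i. \<bar>f i\<bar>) ` Q = V - (\<lambda>i. \<bar>f i\<bar>) ` P"
      using im inj_on_image_set_diff[OF inj, of "P \<union> Q" P] PQ by auto
    then have "zero_ext Q f \<in> signed_arrs Q (V - (\<lambda>i. \<bar>f i\<bar>) ` P)"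
      unfolding zero_ext_in_signed_arrs_iff using inj by (auto simp: bij_betw_def intro: inj_on_subset)
    ultimately show "((\<lambda>i. \<bar>f i\<bar>) ` P, zero_ext P f, zero_ext Q f)
        \<in> (SIGMA U:?I. signed_arrs P U \<times> signed_arrs Q (V - U))" by auto
  next
    fix x assume "x \<in> (SIGMA U:?I. signed_arrs P U \<times> signed_arrs Q (V - U))"
    then obtain U g h where x: "x = (U, g, h)" and U: "U \<subseteq> V" "card U = card P"
      and g: "g \<in> signed_arrs P U" and h: "h \<in> signed_arrs Q (V - U)" by auto
    let ?f = "\<lambda>i. g i + h i"
    have gP: "?f i = g i" if "i \<in> P" for i using h that PQ by (auto simp: signed_arrs_def)
    have hQ: "?f i = h i" if "i \<in> Q" for i using g that PQ by (auto simp: signed_arrs_def)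
    have 1: "bij_betw (\<lambda>i. \<bar>?f i\<bar>) P U"
      using g bij_betw_cong[of P "\<lambda>i. \<bar>?f i\<bar>" "\<lambda>i. \<bar>g i\<bar>" U] gP by (simp add: signed_arrs_def)
    have 2: "bij_betw (\<lambda>i. \<bar>?f i\<bar>) Q (V - U)"
      using h bij_betw_cong[of Q "\<lambda>i. \<bar>?f i\<bar>" "\<lambda>i. \<bar>h i\<bar>" "V - U"] hQ by (simp add: signed_arrs_def)
    have "bij_betw (\<lambda>i. \<bar>?f i\<bar>) (P \<union> Q) (U \<union> (V - U))"
      using bij_betw_combine[OF 1 2] by blast
    then show "(case x of (U, g, h) \<Rightarrow> \<lambda>i. g i + h i) \<in> signed_arrs (P \<union> Q) V"
      using U g h by (simp add: x signed_arrs_def Un_absorb1)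
    have "zero_ext P ?f = g" "zero_ext Q ?f = h"
      using g h PQ by (auto simp: fun_eq_iff zero_ext_def signed_arrs_def)
    moreover have "(\<lambda>i. \<bar>?f i\<bar>) ` P = U" using 1 by (simp add: bij_betw_def)
    ultimately show "(\<lambda>f. ((\<lambda>i. \<bar>f i\<bar>) ` P, zero_ext P f, zero_ext Q f))
        (case x of (U, g, h) \<Rightarrow> \<lambda>i. g i + h i) = x" by (simp add: x)
  qed auto
  finally show ?thesis by simp
qed

text \<open>Blocks are split off one at a time, and the binomial coefficients that count the choices
  of values multiply to a multinomial coefficient. The assumption that block \<open>j\<close> yields
  the same \<open>c j\<close> for every admissible set of values makes the summands independent of
  that choice. \<open>V\<close> varies in the induction because the remaining blocks are filled from
  \<open>V - U\<close>.\<close>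

lemma sum_signed_arrs_UNION:
  fixes v :: "'j \<Rightarrow> ('a \<Rightarrow> int) \<Rightarrow> rat poly"
  assumes "finite J" "\<And>j. j \<in> J \<Longrightarrow> finite (P j)"
    and "disjoint_family_on P J"
    and "\<And>j U. j \<in> J \<Longrightarrow> U \<subseteq> {0<..} \<Longrightarrow> finite U \<Longrightarrow> card U = card (P j) \<Longrightarrow>
            (\<Sum>f\<in>signed_arrs (P j) U. v j f) = c j"
    and "finite V" "V \<subseteq> {0<..}" "card V = (\<Sum>j\<in>J. card (P j))"
  shows "(\<Sum>f\<in>signed_arrs (\<Union>j\<in>J. P j) V. \<Prod>j\<in>J. v j (zero_ext (P j) f)) =
    smult (fact (card V) / (\<Prod>j\<in>J. fact (card (P j)))) (\<Prod>j\<in>J. c j)"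
  using assms
proof (induction J arbitrary: V rule: finite_induct)
  case empty
  have "signed_arrs ({} :: 'a set) ({} :: int set) = {\<lambda>_. 0}"
    by (auto simp: signed_arrs_def fun_eq_iff bij_betw_def)
  with empty show ?case by simp
next
  case (insert a J)
  let ?Q = "\<Union>j\<in>J. P j"
  let ?p = "card (P a)" and ?n = "card V"
  define q where "q = (\<Sum>j\<in>J. card (P j))"
  define D :: rat where "D = (\<Prod>j\<in>J. fact (card (P j)))"
  have n: "?n = ?p + q" using insert by (simp add: q_def)
  have PQ: "P a \<inter> ?Q = {}"
    using insert.prems(2) insert.hyps by (fastforce simp: disjoint_family_on_def)
  have finQ: "finite ?Q" using insert by auto
  \<comment> \<open>Restricting first to \<open>?Q\<close> changes nothing for the blocks inside it;
    it exhibits their joint weight as a function of the restriction to \<open>?Q\<close>.\<close>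
  have "(\<Sum>f\<in>signed_arrs (\<Union>j\<in>insert a J. P j) V. \<Prod>j\<in>insert a J. v j (zero_ext (P j) f)) =
    (\<Sum>f\<in>signed_arrs (P a \<union> ?Q) V.
       v a (zero_ext (P a) f) * (\<Prod>j\<in>J. v j (zero_ext (P j) (zero_ext ?Q f))))"
    using insert.hyps
    by (intro sum.cong) (auto intro!: prod.cong arg_cong[of _ _ "v _"] simp: zero_ext_zero_ext UN_upper)
  also have "\<dots> = (\<Sum>U | U \<subseteq> V \<and> card U = ?p. (\<Sum>f\<in>signed_arrs (P a) U. v a f) *
      (\<Sum>f\<in>signed_arrs ?Q (V - U). \<Prod>j\<in>J. v j (zero_ext (P j) f)))"
    using insert.prems finQ
    by (subst sum_signed_arrs_Un[OF PQ, where v = "\<lambda>f. \<Prod>j\<in>J. v j (zero_ext (P j) f)"]) auto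
  also have "\<dots> = (\<Sum>U | U \<subseteq> V \<and> card U = ?p. c a * smult (fact q / D) (\<Prod>j\<in>J. c j))"
  proof (intro sum.cong refl arg_cong2[of _ _ _ _ "(*)"])
    fix U assume U: "U \<in> {U. U \<subseteq> V \<and> card U = ?p}"
    then have finU: "finite U" using insert.prems finite_subset by blast
    show "(\<Sum>f\<in>signed_arrs (P a) U. v a f) = c a"
      using U finU insert.prems by (intro insert.prems(3)) auto
    have c: "card (V - U) = q" using U n finU by (simp add: card_Diff_subset)
    show "(\<Sum>f\<in>signed_arrs ?Q (V - U). \<Prod>j\<in>J. v j (zero_ext (P j) f)) =
        smult (fact q / D) (\<Prod>j\<in>J. c j)"
      unfolding c[symmetric] D_def
    proof (rule insert.IH)
      show "disjoint_family_on P J"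
        using insert.prems(2) by (rule disjoint_family_on_mono[rotated]) auto
    qed (use insert.prems c in \<open>auto simp: q_def\<close>)
  qed
  \<comment> \<open>The summand no longer involves \<open>U\<close>, so only the number of subsets
    of size \<open>?p\<close> remains.\<close>
  also have "\<dots> = of_nat (?n choose ?p) * (c a * smult (fact q / D) (\<Prod>j\<in>J. c j))"
    using insert.prems by (simp add: n_subsets)
  also have "\<dots> = smult (of_nat (?n choose ?p) * (fact q / D)) (\<Prod>j\<in>insert a J. c j)"
    using insert.hyps by (simp add: of_nat_poly mult_ac)
  also have "of_nat (?n choose ?p) * (fact q / D) = fact ?n / (\<Prod>j\<in>insert a J. fact (card (P j)))"
    using insert.hyps by (simp add: n binomial_fact D_def)
  finally show ?case .
qed

section \<open>The contribution of one block\<close>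

text \<open>The witness lists \<open>U\<close> in increasing order; the shift \<open>i - 1\<close>
  turns positions starting at \<open>1\<close> into list indices starting at \<open>0\<close>. It
  serves to replace values by their ranks without changing descents.\<close>

lemma obtain_int_set_enumeration:
  fixes U :: "int set"
  assumes "finite U" "card U = m"
  obtains h where "bij_betw h {1..m} U" "strict_mono_on {1..m} h"
proof
  let ?l = "sorted_list_of_set U"
  have len: "length ?l = m" using assms by simp
  have "bij_betw (\<lambda>i. i - 1) {1..m} {..<m}"
    by (rule bij_betw_byWitness[where f' = Suc]) auto
  moreover have "bij_betw ((!) ?l) {..<m} U"
    by (rule bij_betw_nth) (use assms len in auto)
  ultimately have "bij_betw ((!) ?l \<circ> (\<lambda>i. i - 1)) {1..m} U" by (rule bij_betw_trans)
  then show "bij_betw (\<lambda>i. ?l ! (i - 1)) {1..m} U" by (simp add: comp_def)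
  show "strict_mono_on {1..m} (\<lambda>i. ?l ! (i - 1))"
    using len by (auto intro!: strict_mono_onI sorted_wrt_nth_less[OF strict_sorted_list_of_set])
qed

section \<open>Signed permutations as words indexed by natural numbers\<close>

text \<open>The bound is written \<open>i + k \<le> n\<close> because the truncated difference
  \<open>n - k\<close> would admit \<open>i = 0\<close> when \<open>k > n\<close>. Position
  \<open>0\<close> is included; there the arrangements on \<open>{1..n}\<close> take the value
  \<open>0\<close>.\<close>

definition gap_descents :: "nat \<Rightarrow> nat \<Rightarrow> (nat \<Rightarrow> int) \<Rightarrow> nat" where
  "gap_descents n k f = card {i. i + k \<le> n \<and> f (i + k) < f i}"

text \<open>A signed permutation is odd and is the identity off its support, so its values at
  \<open>1, ..., n\<close> determine it; their absolute values run through \<open>1, ..., n\<close>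
  once each.\<close>

lemma sum_signed_perms:
  "(\<Sum>\<pi>\<in>signed_perms n. F (zero_ext {1..n} (\<lambda>i. \<pi> (int i)))) =
   (\<Sum>f\<in>signed_arrs {1..n} {1..int n}. F f)"
proof -
  \<comment> \<open>The inverse map: the odd extension of a word, and the identity elsewhere as
    \<open>permutes\<close> demands.\<close>
  define ext :: "(nat \<Rightarrow> int) \<Rightarrow> int \<Rightarrow> int" where
    "ext f x = (if \<bar>x\<bar> \<in> {1..int n} then sgn x * f (nat \<bar>x\<bar>) else x)" for f x
  let ?S = "{- int n..int n} - {0}"
  have S: "x \<in> ?S \<longleftrightarrow> \<bar>x\<bar> \<in> {1..int n}" for x by auto
  show ?thesis
  proof (rule sum.reindex_bij_witness[where i = ext and
        j = "\<lambda>\<pi>. zero_ext {1..n} (\<lambda>i. \<pi> (int i))"])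
    fix \<pi> assume "\<pi> \<in> signed_perms n"
    then have perm: "\<pi> permutes ?S" and odd: "\<And>x. x \<in> ?S \<Longrightarrow> \<pi> (- x) = - \<pi> x"
      by (auto simp: signed_perms_def)
    show "ext (zero_ext {1..n} (\<lambda>i. \<pi> (int i))) = \<pi>"
    proof
      fix x
      show "ext (zero_ext {1..n} (\<lambda>i. \<pi> (int i))) x = \<pi> x"
      proof (cases "x \<in> ?S")
        case True
        then show ?thesis
          using odd[OF True] by (cases "x > 0") (auto simp: ext_def zero_ext_def)
      next
        case False
        then have "\<bar>x\<bar> \<notin> {1..int n}" unfolding S .
        then show ?thesis
          unfolding ext_def using permutes_not_in[OF perm False] by (simp only: if_False)
      qed
    qed
    have inS: "\<pi> x \<in> ?S" if "x \<in> ?S" for x using permutes_in_image[OF perm] that by blast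
    have "inj_on (\<lambda>i. \<bar>\<pi> (int i)\<bar>) {1..n}"
    proof (rule inj_onI)
      fix i j assume ij: "i \<in> {1..n}" "j \<in> {1..n}" and eq: "\<bar>\<pi> (int i)\<bar> = \<bar>\<pi> (int j)\<bar>"
      \<comment> \<open>By oddness, equal absolute values mean that \<open>\<pi>\<close> agrees at
        \<open>i\<close> and at \<open>j\<close> or \<open>-j\<close>; injectivity and positivity of
        the positions then leave \<open>i = j\<close>.\<close>
      then have "\<pi> (int i) = \<pi> (int j) \<or> \<pi> (int i) = \<pi> (- int j)"
        using odd[of "int j"] by (auto simp: abs_eq_iff)
      then have "int i = int j \<or> int i = - int j"
        using injD[OF permutes_inj[OF perm]] by blast
      then show "i = j" using ij by auto
    qed
    moreover have "(\<lambda>i. \<bar>\<pi> (int i)\<bar>) ` {1..n} \<subseteq> {1..int n}"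
      using inS unfolding S by auto
    ultimately have "bij_betw (\<lambda>i. \<bar>\<pi> (int i)\<bar>) {1..n} {1..int n}"
      unfolding bij_betw_def by (intro conjI card_subset_eq) (simp_all add: card_image)
    then show "zero_ext {1..n} (\<lambda>i. \<pi> (int i)) \<in> signed_arrs {1..n} {1..int n}"
      by (simp only: zero_ext_in_signed_arrs_iff)
  next
    fix f assume f: "f \<in> signed_arrs {1..n} {1..int n}"
    then have inj: "inj_on (\<lambda>i. \<bar>f i\<bar>) {1..n}"
      and im: "(\<lambda>i. \<bar>f i\<bar>) ` {1..n} = {1..int n}"
      by (auto simp: signed_arrs_def bij_betw_def)
    show "zero_ext {1..n} (\<lambda>i. ext f (int i)) = f"
      using f by (auto simp: fun_eq_iff zero_ext_def ext_def signed_arrs_def)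
    have rng: "\<bar>f (nat \<bar>x\<bar>)\<bar> \<in> {1..int n}" if "x \<in> ?S" for x
    proof -
      have "nat \<bar>x\<bar> \<in> {1..n}" using that by auto
      then show ?thesis using im by blast
    qed
    have abs: "\<bar>ext f x\<bar> = \<bar>f (nat \<bar>x\<bar>)\<bar>" if "x \<in> ?S" for x
      using that unfolding S ext_def by (cases "x = 0") (simp_all add: abs_mult)
    have "inj_on (ext f) ?S"
    proof (rule inj_onI)
      fix x y assume xy: "x \<in> ?S" "y \<in> ?S" and eq: "ext f x = ext f y"
      have "\<bar>f (nat \<bar>x\<bar>)\<bar> = \<bar>f (nat \<bar>y\<bar>)\<bar>" using abs xy eq by metis
      moreover have "nat \<bar>x\<bar> \<in> {1..n}" "nat \<bar>y\<bar> \<in> {1..n}" using xy by auto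
      ultimately have "nat \<bar>x\<bar> = nat \<bar>y\<bar>" using inj by (auto dest: inj_onD)
      then have "\<bar>x\<bar> = \<bar>y\<bar>" by simp
      moreover have "sgn x * f (nat \<bar>x\<bar>) = sgn y * f (nat \<bar>y\<bar>)"
        using eq xy unfolding S ext_def by simp
      \<comment> \<open>The common factor \<open>f (nat \<bar>x\<bar>)\<close> has absolute value at
        least \<open>1\<close>, so it cancels.\<close>
      ultimately have "sgn x = sgn y" using rng[OF xy(1)] by auto
      then show "x = y" using \<open>\<bar>x\<bar> = \<bar>y\<bar>\<close> by (metis mult_sgn_abs)
    qed
    moreover have "ext f ` ?S \<subseteq> ?S"
    proof (rule image_subsetI)
      fix x assume "x \<in> ?S"
      then show "ext f x \<in> ?S" using rng abs unfolding S by metis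
    qed
    ultimately have "bij_betw (ext f) ?S ?S"
      unfolding bij_betw_def by (intro conjI endo_inj_surj) simp_all
    then have "ext f permutes ?S"
      by (rule bij_imp_permutes) (simp only: S ext_def if_False)
    then show "ext f \<in> signed_perms n"
      by (simp add: signed_perms_def ext_def)
  qed simp
qed

lemma des_B_eq_gap_descents:
  assumes "\<pi> \<in> signed_perms n" "k \<ge> 1"
  shows "des_B n k \<pi> = gap_descents n k (zero_ext {1..n} (\<lambda>i. \<pi> (int i)))"
proof -
  let ?f = "zero_ext {1..n} (\<lambda>i. \<pi> (int i))"
  \<comment> \<open>The point \<open>0\<close> lies off the support, hence is fixed; this matches
    the default \<open>0\<close> of \<open>zero_ext\<close> at position \<open>0\<close>.\<close>
  have "\<pi> 0 = 0" using assms by (auto simp: signed_perms_def permutes_def)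
  then have f: "?f i = \<pi> (int i)" if "i \<le> n" for i
    using that by (cases "i = 0") auto
  have "{i \<in> {0..int n - int k}. \<pi> i > \<pi> (i + int k)} = int ` {i. i + k \<le> n \<and> ?f (i + k) < ?f i}"
  proof (rule set_eqI)
    fix x
    show "x \<in> {i \<in> {0..int n - int k}. \<pi> i > \<pi> (i + int k)} \<longleftrightarrow>
        x \<in> int ` {i. i + k \<le> n \<and> ?f (i + k) < ?f i}"
      by (cases x) (auto simp: f[unfolded One_nat_def] simp flip: of_nat_add)
  qed
  then show ?thesis by (simp add: des_B_def gap_descents_def card_image)
qed

lemma neg_card_eq_neg_count:
  "card {i \<in> {1..int n}. \<pi> i < 0} = neg_count {1..n} (zero_ext {1..n} (\<lambda>i. \<pi> (int i)))"
proof -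
  have "{i \<in> {1..int n}. \<pi> i < 0} = int ` {i \<in> {1..n}. zero_ext {1..n} (\<lambda>i. \<pi> (int i)) i < 0}"
  proof (rule set_eqI)
    fix x
    show "x \<in> {i \<in> {1..int n}. \<pi> i < 0} \<longleftrightarrow>
        x \<in> int ` {i \<in> {1..n}. zero_ext {1..n} (\<lambda>i. \<pi> (int i)) i < 0}"
      by (cases x) auto
  qed
  then show ?thesis by (simp add: neg_count_def card_image)
qed

lemma smult_sum_right: "smult c (\<Sum>i\<in>A. f i) = (\<Sum>i\<in>A. smult c (f i))"
  by (induction A rule: infinite_finite_induct) (simp_all add: smult_add_right)

section \<open>Blocks without a leading zero: type A\<close>

text \<open>Composing a permutation of the ranks with the increasing enumeration of \<open>U\<close>
  preserves all comparisons and reaches every bijection onto \<open>U\<close> once. The coefficient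
  \<open>c\<close> later carries the sign weight.\<close>

lemma sum_bijections_descents:
  assumes "finite U" "card U = m"
  shows "(\<Sum>g\<in>bijections {1..m} U. monom c (card {i \<in> {1..<m}. g (i + 1) < g i})) =
    smult c (eulerian_A m)"
proof -
  obtain h where h: "bij_betw h {1..m} U" and mono: "strict_mono_on {1..m} h"
    using obtain_int_set_enumeration[OF assms] .
  let ?inv = "inv_into {1..m} h"
  have h_inv: "h (?inv u) = u" "?inv u \<in> {1..m}" if "u \<in> U" for u
    using h that by (auto simp: bij_betw_def f_inv_into_f simp del: atLeastAtMost_iff intro: inv_into_into)
  have inv_h: "?inv (h i) = i" "h i \<in> U" if "i \<in> {1..m}" for i
    using h that by (auto simp: bij_betw_def)
  have "(\<Sum>\<sigma> | \<sigma> permutes {1..m}. monom c (des_A m \<sigma>)) =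
     (\<Sum>g\<in>bijections {1..m} U. monom c (card {i \<in> {1..<m}. g (i + 1) < g i}))"
  proof (rule sum.reindex_bij_witness[where j = "\<lambda>\<sigma>. zero_ext {1..m} (h \<circ> \<sigma>)" and
        i = "\<lambda>g i. if i \<in> {1..m} then ?inv (g i) else i"])
    fix \<sigma> assume "\<sigma> \<in> {\<sigma>. \<sigma> permutes {1..m}}"
    then have p: "\<sigma> permutes {1..m}" by simp
    have \<sigma>: "\<sigma> i \<in> {1..m}" if "i \<in> {1..m}" for i using permutes_in_image[OF p] that by blast
    show "(\<lambda>i. if i \<in> {1..m} then ?inv (zero_ext {1..m} (h \<circ> \<sigma>) i) else i) = \<sigma>"
    proof
      fix i show "(if i \<in> {1..m} then ?inv (zero_ext {1..m} (h \<circ> \<sigma>) i) else i) = \<sigma> i"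
      proof (cases "i \<in> {1..m}")
        case True
        then show ?thesis using inv_h(1)[OF \<sigma>[OF True]] by simp
      next
        case False
        then show ?thesis using permutes_not_in[OF p False] False by (simp only: if_False)
      qed
    qed
    have "bij_betw (h \<circ> \<sigma>) {1..m} U"
      using permutes_imp_bij[OF p] h by (rule bij_betw_trans)
    then have "bij_betw (zero_ext {1..m} (h \<circ> \<sigma>)) {1..m} U"
      using bij_betw_cong[of "{1..m}" "zero_ext {1..m} (h \<circ> \<sigma>)" "h \<circ> \<sigma>" U] by simp
    then show "zero_ext {1..m} (h \<circ> \<sigma>) \<in> bijections {1..m} U"
      unfolding bijections_def by simp
    have "{i \<in> {1..<m}. zero_ext {1..m} (h \<circ> \<sigma>) (i + 1) < zero_ext {1..m} (h \<circ> \<sigma>) i} =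
        {i \<in> {1..<m}. \<sigma> i > \<sigma> (i + 1)}"
    proof (rule Collect_cong, rule conj_cong[OF refl])
      fix i assume "i \<in> {1..<m}"
      then have "i \<in> {1..m}" "i + 1 \<in> {1..m}" by auto
      then show "zero_ext {1..m} (h \<circ> \<sigma>) (i + 1) < zero_ext {1..m} (h \<circ> \<sigma>) i \<longleftrightarrow> \<sigma> i > \<sigma> (i + 1)"
        using strict_mono_on_less[OF mono \<sigma> \<sigma>] by simp
    qed
    then show "monom c (card {i \<in> {1..<m}.
        zero_ext {1..m} (h \<circ> \<sigma>) (i + 1) < zero_ext {1..m} (h \<circ> \<sigma>) i}) = monom c (des_A m \<sigma>)"
      by (simp add: des_A_def)
  next
    fix g assume "g \<in> bijections {1..m} U"
    then have g: "bij_betw g {1..m} U" and g0: "\<And>i. i \<notin> {1..m} \<Longrightarrow> g i = 0"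
      by (auto simp: bijections_def)
    have gU: "g i \<in> U" if "i \<in> {1..m}" for i using g that by (auto simp: bij_betw_def)
    show "zero_ext {1..m} (h \<circ> (\<lambda>i. if i \<in> {1..m} then ?inv (g i) else i)) = g"
      using h_inv(1)[OF gU] g0 by (auto simp: fun_eq_iff zero_ext_def simp del: atLeastAtMost_iff)
    have "bij_betw (?inv \<circ> g) {1..m} {1..m}"
      using g bij_betw_inv_into[OF h] by (rule bij_betw_trans)
    then have "bij_betw (\<lambda>i. if i \<in> {1..m} then ?inv (g i) else i) {1..m} {1..m}"
      using bij_betw_cong[of "{1..m}" "\<lambda>i. if i \<in> {1..m} then ?inv (g i) else i" "?inv \<circ> g" "{1..m}"]
      by simp
    then show "(\<lambda>i. if i \<in> {1..m} then ?inv (g i) else i) \<in> {\<sigma>. \<sigma> permutes {1..m}}"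
      by (intro CollectI bij_imp_permutes) auto
  qed
  moreover have "smult c (eulerian_A m) = (\<Sum>\<sigma> | \<sigma> permutes {1..m}. monom c (des_A m \<sigma>))"
    by (simp add: eulerian_A_def smult_sum_right smult_monom)
  ultimately show ?thesis by simp
qed

text \<open>Here \<open>N\<close> is the set of absolute values that occur with a negative sign.\<close>

lemma signed_arrs_eq_UN_bijections:
  assumes V: "V \<subseteq> {0<..}"
  shows "signed_arrs P V = (\<Union>N\<in>Pow V. bijections P ((V - N) \<union> uminus ` N))"
proof (intro equalityI subsetI)
  fix f assume f: "f \<in> signed_arrs P V"
  then have inj: "inj_on (\<lambda>i. \<bar>f i\<bar>) P" and im: "(\<lambda>i. \<bar>f i\<bar>) ` P = V"
    by (auto simp: signed_arrs_def bij_betw_def)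
  define N where "N = {x \<in> V. - x \<in> f ` P}"
  have "f ` P = (V - N) \<union> uminus ` N"
  proof (intro equalityI subsetI)
    fix y assume "y \<in> f ` P"
    then obtain i where i: "i \<in> P" "y = f i" by auto
    then have yV: "\<bar>y\<bar> \<in> V" using im by auto
    show "y \<in> (V - N) \<union> uminus ` N"
    proof (cases "y < 0")
      case True
      then have "- y \<in> N" using yV i by (auto simp: N_def)
      then show ?thesis by force
    next
      case False
      \<comment> \<open>If \<open>y\<close> and \<open>-y\<close> were both values of
        \<open>f\<close>, injectivity of the absolute values would put them at the same position,
        forcing \<open>y = 0\<close>, which is not in \<open>V\<close>.\<close>
      have "y \<notin> N"
      proof
        assume "y \<in> N"
        then obtain j where j: "j \<in> P" "f j = - y" by (auto simp: N_def)
        then have "j = i" using i by (intro inj_onD[OF inj]) auto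
        then show False using i j yV V by auto
      qed
      then show ?thesis using False yV by auto
    qed
  next
    fix y assume "y \<in> (V - N) \<union> uminus ` N"
    then consider "y \<in> V" "y \<notin> N" | "- y \<in> N" by force
    then show "y \<in> f ` P"
    proof cases
      case 1
      then obtain i where i: "i \<in> P" "y = \<bar>f i\<bar>" using im by auto
      then show ?thesis using 1 by (cases "f i \<ge> 0") (auto simp: N_def)
    qed (simp add: N_def)
  qed
  moreover have "inj_on f P" using inj by (auto simp: inj_on_def)
  ultimately have "f \<in> bijections P ((V - N) \<union> uminus ` N)"
    using f by (simp add: bijections_def signed_arrs_def bij_betw_def)
  moreover have "N \<in> Pow V" by (auto simp: N_def)
  ultimately show "f \<in> (\<Union>N\<in>Pow V. bijections P ((V - N) \<union> uminus ` N))" by blast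
next
  fix f assume "f \<in> (\<Union>N\<in>Pow V. bijections P ((V - N) \<union> uminus ` N))"
  then obtain N where N: "N \<subseteq> V" and f: "f \<in> bijections P ((V - N) \<union> uminus ` N)" by auto
  have pos: "0 < x" if "x \<in> V" for x using V that by auto
  have posN: "0 < x" if "x \<in> N" for x using pos N that by blast
  \<comment> \<open>\<open>abs\<close> fixes \<open>V - N\<close> and sends the negatives of
    \<open>N\<close> back to \<open>N\<close>, and these two images partition
    \<open>V\<close>.\<close>
  have "bij_betw abs ((V - N) \<union> uminus ` N) V"
    unfolding bij_betw_def
  proof
    show "inj_on abs ((V - N) \<union> uminus ` N)"
      using pos posN by (auto simp: inj_on_def abs_if dest: pos posN)
    show "abs ` ((V - N) \<union> uminus ` N) = V"
    proof (intro equalityI subsetI)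
      fix y assume "y \<in> V"
      then show "y \<in> abs ` ((V - N) \<union> uminus ` N)"
        using pos[of y] by (cases "y \<in> N") (auto simp: image_Un image_image image_iff intro: bexI[of _ y])
    qed (use N in \<open>auto simp: abs_if dest: pos posN\<close>)
  qed
  then have "bij_betw (abs \<circ> f) P V"
    using f by (intro bij_betw_trans[of f]) (auto simp: bijections_def)
  then show "f \<in> signed_arrs P V"
    using f by (simp add: bijections_def signed_arrs_def comp_def)
qed

text \<open>Elements of \<open>V - N\<close> are positive, so the negative values are exactly the
  negatives of \<open>N\<close>, each taken at one position.\<close>

lemma neg_count_bijections:
  assumes V: "V \<subseteq> {0<..}" and N: "N \<subseteq> V" and g: "g \<in> bijections P ((V - N) \<union> uminus ` N)"
  shows "neg_count P g = card N"
proof -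
  have inj: "inj_on g P" and im: "g ` P = (V - N) \<union> uminus ` N"
    using g by (auto simp: bijections_def bij_betw_def)
  have "g ` {i \<in> P. g i < 0} = {y \<in> g ` P. y < 0}" by auto
  also have "\<dots> = uminus ` N" unfolding im using V N by force
  finally have "card (g ` {i \<in> P. g i < 0}) = card (uminus ` N)" by simp
  moreover have "inj_on g {i \<in> P. g i < 0}" using inj by (rule inj_on_subset) auto
  ultimately show ?thesis by (simp add: neg_count_def card_image)
qed

text \<open>Expanding the product over \<open>A\<close> of the factors \<open>1 + s\<close> selects
  a subset \<open>N\<close> of the elements that contribute \<open>s\<close>.\<close>

lemma sum_power_card_Pow:
  fixes s :: "'b::comm_ring_1"
  assumes "finite A"
  shows "(\<Sum>N\<in>Pow A. s ^ card N) = (1 + s) ^ card A"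
  using prod_add[OF assms, of "\<lambda>_. s" "\<lambda>_. 1"] by (simp add: add.commute)

text \<open>Fixing the set \<open>N\<close> of negated absolute values fixes a value set of size
  \<open>m\<close>. Descents see only ranks, so each \<open>N\<close> contributes the type A
  polynomial times \<open>s ^ card N\<close>, and summing over \<open>N\<close> gives the power of
  \<open>1 + s\<close>.\<close>

lemma sum_signed_arrs_descents:
  fixes s :: rat
  assumes V: "V \<subseteq> {0<..}" "finite V" "card V = m"
  shows "(\<Sum>f\<in>signed_arrs {1..m} V.
      monom (s ^ neg_count {1..m} f) (card {i \<in> {1..<m}. f (i + 1) < f i})) =
    smult ((1 + s) ^ m) (eulerian_A m)"
proof -
  let ?U = "\<lambda>N. (V - N) \<union> uminus ` N"
  let ?w = "\<lambda>f. monom (s ^ neg_count {1..m} f) (card {i \<in> {1..<m}. f (i + 1) < f i})"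
  have pos: "0 < x" if "x \<in> V" for x using V that by auto
  have fin: "finite N" if "N \<in> Pow V" for N using that V finite_subset by auto
  \<comment> \<open>A positive set never contains both \<open>x\<close> and \<open>-x\<close>, so
    the value set determines \<open>N\<close>; hence different \<open>N\<close> give disjoint
    families of bijections.\<close>
  have U_inj: "N = {x \<in> V. - x \<in> ?U N}" if "N \<in> Pow V" for N
  proof -
    have "- x \<notin> V" if "x \<in> V" for x using pos[of x] pos[of "- x"] that by auto
    moreover have "- x \<in> uminus ` N \<longleftrightarrow> x \<in> N" for x by (auto simp: image_iff)
    ultimately show ?thesis using that by auto
  qed
  have "(\<Sum>f\<in>signed_arrs {1..m} V. ?w f) = (\<Sum>N\<in>Pow V. \<Sum>g\<in>bijections {1..m} (?U N). ?w g)"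
    unfolding signed_arrs_eq_UN_bijections[OF V(1)]
  proof (rule sum.UNION_disjoint)
    show "\<forall>N\<in>Pow V. finite (bijections {1..m} (?U N))"
      using V(2) fin by (auto intro!: finite_bijections)
    show "\<forall>N\<in>Pow V. \<forall>M\<in>Pow V. N \<noteq> M \<longrightarrow>
        bijections {1..m} (?U N) \<inter> bijections {1..m} (?U M) = {}"
    proof (intro ballI impI)
      fix N M assume NM: "N \<in> Pow V" "M \<in> Pow V" "N \<noteq> M"
      then have "?U N \<noteq> ?U M" using U_inj by metis
      then show "bijections {1..m} (?U N) \<inter> bijections {1..m} (?U M) = {}"
        by (auto simp: bijections_def bij_betw_def)
    qed
  qed (use V in simp)
  also have "\<dots> = (\<Sum>N\<in>Pow V. smult (s ^ card N) (eulerian_A m))"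
  proof (rule sum.cong[OF refl])
    fix N assume N: "N \<in> Pow V"
    have "(V - N) \<inter> uminus ` N = {}" using N pos by (auto, fastforce dest: pos)
    then have "card (?U N) = card (V - N) + card (uminus ` N)"
      using V(2) fin[OF N] by (intro card_Un_disjoint) auto
    also have "\<dots> = m"
      using N V fin[OF N] card_mono[of V N] by (simp add: card_image card_Diff_subset)
    finally have c: "card (?U N) = m" .
    have "(\<Sum>g\<in>bijections {1..m} (?U N). ?w g) = (\<Sum>g\<in>bijections {1..m} (?U N).
        monom (s ^ card N) (card {i \<in> {1..<m}. g (i + 1) < g i}))"
      using N by (intro sum.cong refl) (simp add: neg_count_bijections[OF V(1)])
    also have "\<dots> = smult (s ^ card N) (eulerian_A m)"
      using V fin[OF N] c by (intro sum_bijections_descents) auto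
    finally show "(\<Sum>g\<in>bijections {1..m} (?U N). ?w g) = smult (s ^ card N) (eulerian_A m)" .
  qed
  also have "\<dots> = smult (\<Sum>N\<in>Pow V. s ^ card N) (eulerian_A m)"
    by (simp add: smult_sum)
  finally show ?thesis using V by (simp add: sum_power_card_Pow)
qed

section \<open>Blocks with a leading zero: type B\<close>

text \<open>This is Brenti's q-analogue of the type B Eulerian polynomial, with \<open>s\<close>
  marking the negative entries.\<close>

definition eulerian_B_signed :: "rat \<Rightarrow> nat \<Rightarrow> rat poly" where
  "eulerian_B_signed s d = (\<Sum>f\<in>signed_arrs {1..d} {1..int d}.
     monom (s ^ neg_count {1..d} f) (gap_descents d 1 f))"

lemma eulerian_B_signed_1: "eulerian_B_signed 1 d = eulerian_B d"
proof -
  have "eulerian_B d = (\<Sum>\<pi>\<in>signed_perms d.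
      monom 1 (gap_descents d 1 (zero_ext {1..d} (\<lambda>i. \<pi> (int i)))))"
    unfolding eulerian_B_def by (intro sum.cong refl arg_cong[of _ _ "monom 1"] des_B_eq_gap_descents) auto
  also have "\<dots> = eulerian_B_signed 1 d"
    unfolding eulerian_B_signed_def power_one by (rule sum_signed_perms)
  finally show ?thesis ..
qed

text \<open>The odd extension of the increasing enumeration of \<open>V\<close> is increasing across
  \<open>0\<close> as well. It therefore preserves the signs and also the comparison with the
  leading zero.\<close>

lemma sum_signed_arrs_gap_descents:
  fixes s :: rat
  assumes V: "V \<subseteq> {0<..}" "finite V" "card V = d"
  shows "(\<Sum>f\<in>signed_arrs {1..d} V. monom (s ^ neg_count {1..d} f) (gap_descents d 1 f)) =
    eulerian_B_signed s d"
proof -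
  obtain h where h: "bij_betw h {1..d} V" and mono: "strict_mono_on {1..d} h"
    using obtain_int_set_enumeration[OF V(2,3)] .
  define \<psi> where "\<psi> x = sgn x * h (nat \<bar>x\<bar>)" for x :: int
  have hpos: "h i > 0" if "i \<in> {1..d}" for i using h V that by (auto simp: bij_betw_def)
  have "bij_betw nat {1..int d} {1..d}"
    by (rule bij_betw_byWitness[where f' = int]) auto
  then have "bij_betw (h \<circ> nat) {1..int d} V" using h by (rule bij_betw_trans)
  then have bij: "bij_betw \<psi> {1..int d} V"
    by (rule iffD1[OF bij_betw_cong, rotated]) (simp add: \<psi>_def)
  have mono\<psi>: "\<psi> x < \<psi> y" if "x < y" "\<bar>x\<bar> \<le> int d" "\<bar>y\<bar> \<le> int d" for x y
  proof -
    \<comment> \<open>Given \<open>x < y\<close>, the first two cases put both points on the same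
      side of \<open>0\<close>, where \<open>h\<close> decides; in the third the signs alone
      decide.\<close>
    consider "x > 0" | "y < 0" | "x \<le> 0" "y \<ge> 0" by linarith
    then show ?thesis
    proof cases
      case 1
      then show ?thesis using that
        by (auto simp: \<psi>_def intro!: strict_mono_onD[OF mono])
    next
      case 2
      then show ?thesis using that
        by (auto simp: \<psi>_def intro!: strict_mono_onD[OF mono])
    next
      case 3
      have hx: "0 < h (nat (- x))" if "x < 0"
        by (rule hpos) (use that \<open>\<bar>x\<bar> \<le> int d\<close> in auto)
      have hy: "0 < h (nat y)" if "y > 0"
        by (rule hpos) (use that \<open>\<bar>y\<bar> \<le> int d\<close> in auto)
      have "\<psi> x \<le> 0" "x < 0 \<Longrightarrow> \<psi> x < 0"
        using 3 hx by (auto simp: \<psi>_def sgn_if less_le)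
      moreover have "\<psi> y \<ge> 0" "y > 0 \<Longrightarrow> \<psi> y > 0"
        using 3 hy by (auto simp: \<psi>_def sgn_if less_le)
      ultimately show ?thesis using 3 that by fastforce
    qed
  qed
  then have \<psi>_less: "\<psi> x < \<psi> y \<longleftrightarrow> x < y" if "\<bar>x\<bar> \<le> int d" "\<bar>y\<bar> \<le> int d" for x y
    using that by (metis less_irrefl less_linear order.asym)
  have "\<psi> 0 = 0" by (simp add: \<psi>_def)
  have "(\<Sum>f\<in>signed_arrs {1..d} V. monom (s ^ neg_count {1..d} f) (gap_descents d 1 f)) =
    (\<Sum>f\<in>signed_arrs {1..d} {1..int d}.
       monom (s ^ neg_count {1..d} (\<psi> \<circ> f)) (gap_descents d 1 (\<psi> \<circ> f)))"
    by (rule sum_signed_arrs_relabel[symmetric, OF _ bij _ V(1)]) (auto simp: \<psi>_def)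
  also have "\<dots> = eulerian_B_signed s d"
    unfolding eulerian_B_signed_def
  proof (intro sum.cong refl)
    fix f assume f: "f \<in> signed_arrs {1..d} {1..int d}"
    have b: "\<bar>f i\<bar> \<le> int d" for i
    proof (cases "i \<in> {1..d}")
      case True
      then have "\<bar>f i\<bar> \<in> {1..int d}" using f unfolding signed_arrs_def bij_betw_def by blast
      then show ?thesis by simp
    qed (simp add: signed_arrs_outside[OF f])
    have "\<psi> (f i) < 0 \<longleftrightarrow> f i < 0" for i
      using \<psi>_less[OF b, of 0 i] \<open>\<psi> 0 = 0\<close> by simp
    then show "monom (s ^ neg_count {1..d} (\<psi> \<circ> f)) (gap_descents d 1 (\<psi> \<circ> f)) =
        monom (s ^ neg_count {1..d} f) (gap_descents d 1 f)"
      by (simp add: neg_count_def gap_descents_def \<psi>_less[OF b b])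
  qed
  finally show ?thesis .
qed

section \<open>Residue classes of positions\<close>

lemma neg_count_zero_ext_comp:
  assumes "bij_betw e T P"
  shows "neg_count T (zero_ext T (g \<circ> e)) = neg_count P g"
proof -
  have "bij_betw e {t \<in> T. zero_ext T (g \<circ> e) t < 0} {i \<in> P. g i < 0}"
    using assms by (auto simp: bij_betw_def inj_on_def)
  then show ?thesis by (simp add: neg_count_def bij_betw_same_card)
qed

text \<open>For \<open>t < d\<close> the left side is below \<open>(t + 1) * k \<le> d * k\<close>,
  and for \<open>t > d\<close> it is at least \<open>(d + 1) * k > d * k + r\<close>; only
  \<open>t = d\<close> depends on comparing \<open>j\<close> with \<open>r\<close>.\<close>

lemma residue_add_mult_le_iff:
  fixes j k r t d :: nat
  assumes "j < k" "r < k"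
  shows "j + t * k \<le> d * k + r \<longleftrightarrow> t < (if j \<le> r then d + 1 else d)"
proof -
  consider "t < d" | "t = d" | "d < t" by linarith
  then show ?thesis
  proof cases
    case 1
    then have "(t + 1) * k \<le> d * k" by (intro mult_right_mono) auto
    then show ?thesis using 1 assms by (auto simp: algebra_simps)
  next
    case 2
    then show ?thesis by simp
  next
    case 3
    then have "(d + 1) * k \<le> t * k" by (intro mult_right_mono) auto
    then show ?thesis using 3 assms by (auto simp: algebra_simps)
  qed
qed

text \<open>Position \<open>0\<close> is left out because its value is fixed and uses up no absolute
  value.\<close>

definition residue_class :: "nat \<Rightarrow> nat \<Rightarrow> nat \<Rightarrow> nat set" where
  "residue_class n k j = {i \<in> {1..n}. i mod k = j}"

text \<open>The descent index \<open>i\<close> may be \<open>0\<close>, so for \<open>j = 0\<close>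
  the comparison of the leading zero with position \<open>k\<close> is counted.\<close>

definition residue_weight :: "rat \<Rightarrow> nat \<Rightarrow> nat \<Rightarrow> nat \<Rightarrow> (nat \<Rightarrow> int) \<Rightarrow> rat poly" where
  "residue_weight s n k j g = monom (s ^ neg_count (residue_class n k j) g)
     (card {i. i + k \<le> n \<and> i mod k = j \<and> g (i + k) < g i})"

lemma bij_betw_residue_class_0:
  assumes n: "n = d * k + r" and r: "r < k"
  shows "bij_betw (\<lambda>t. t * k) {1..d} (residue_class n k 0)"
proof (rule bij_betw_byWitness[where f' = "\<lambda>i. i div k"])
  have le: "t * k \<le> n \<longleftrightarrow> t \<le> d" for t
    using residue_add_mult_le_iff[of 0 k r t d] r n by auto
  show "(\<lambda>t. t * k) ` {1..d} \<subseteq> residue_class n k 0"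
  proof (rule image_subsetI)
    fix t assume "t \<in> {1..d}"
    moreover from this have "t * k \<le> n" using le by simp
    ultimately show "t * k \<in> residue_class n k 0" using r by (simp add: residue_class_def)
  qed
  show "(\<lambda>i. i div k) ` residue_class n k 0 \<subseteq> {1..d}"
  proof (rule image_subsetI)
    fix i assume "i \<in> residue_class n k 0"
    then have i: "1 \<le> i" "i \<le> n" "i div k * k = i"
      by (auto simp: residue_class_def mod_eq_0_iff_dvd)
    then have "i div k \<noteq> 0" by (metis mult_0 not_one_le_zero)
    then show "i div k \<in> {1..d}" using i le[of "i div k"] by simp
  qed
  show "\<forall>t\<in>{1..d}. t * k div k = t" using r by simp
  show "\<forall>i\<in>residue_class n k 0. i div k * k = i"
    unfolding residue_class_def by (simp add: mod_eq_0_iff_dvd)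
qed

text \<open>The first position of a nonzero class is \<open>j\<close> itself, reached at
  \<open>t = 1\<close>, hence the factor \<open>t - 1\<close>; the class of \<open>0\<close> starts
  at \<open>k\<close> instead.\<close>

lemma bij_betw_residue_class:
  assumes n: "n = d * k + r" and r: "r < k" and j: "0 < j" "j < k"
  shows "bij_betw (\<lambda>t. j + (t - 1) * k) {1..if j \<le> r then d + 1 else d} (residue_class n k j)"
proof (rule bij_betw_byWitness[where f' = "\<lambda>i. i div k + 1"])
  let ?m = "if j \<le> r then d + 1 else d"
  have le: "j + t * k \<le> n \<longleftrightarrow> t < ?m" for t
    using residue_add_mult_le_iff[of j k r t d] j r n by simp
  show "\<forall>t\<in>{1..?m}. (j + (t - 1) * k) div k + 1 = t"
    using j by simp
  show "\<forall>i\<in>residue_class n k j. j + (i div k + 1 - 1) * k = i"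
    by (auto simp: residue_class_def)
  show "(\<lambda>t. j + (t - 1) * k) ` {1..?m} \<subseteq> residue_class n k j"
  proof (rule image_subsetI)
    fix t assume "t \<in> {1..?m}"
    then have "t - 1 < ?m" by auto
    then show "j + (t - 1) * k \<in> residue_class n k j"
      using le[of "t - 1"] j by (simp add: residue_class_def)
  qed
  show "(\<lambda>i. i div k + 1) ` residue_class n k j \<subseteq> {1..?m}"
  proof (rule image_subsetI)
    fix i assume "i \<in> residue_class n k j"
    then have "i mod k = j" "i \<le> n" by (auto simp: residue_class_def)
    then have "j + (i div k) * k \<le> n" by auto
    then show "i div k + 1 \<in> {1..?m}" using le[of "i div k"] by simp
  qed
qed

section \<open>The contribution of each residue class\<close>

text \<open>Numbering the positions \<open>0, k, ..., d * k\<close> by \<open>0, ..., d\<close>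
  turns gap \<open>k\<close> into gap \<open>1\<close>, and position \<open>0\<close> supplies the
  leading zero of type B.\<close>

lemma sum_residue_weight_0:
  assumes n: "n = d * k + r" and r: "r < k"
    and V: "V \<subseteq> {0<..}" "finite V" "card V = d"
  shows "(\<Sum>g\<in>signed_arrs (residue_class n k 0) V. residue_weight s n k 0 g) = eulerian_B_signed s d"
proof -
  let ?e = "\<lambda>t. t * k"
  let ?P = "residue_class n k 0"
  note bij = bij_betw_residue_class_0[OF n r]
  have le: "t * k \<le> n \<longleftrightarrow> t \<le> d" for t
    using residue_add_mult_le_iff[of 0 k r t d] r n by auto
  have "(\<Sum>g\<in>signed_arrs ?P V. residue_weight s n k 0 g) =
    (\<Sum>g\<in>signed_arrs ?P V. monom (s ^ neg_count {1..d} (zero_ext {1..d} (g \<circ> ?e)))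
       (gap_descents d 1 (zero_ext {1..d} (g \<circ> ?e))))"
  proof (rule sum.cong[OF refl])
    fix g assume g: "g \<in> signed_arrs ?P V"
    let ?h = "zero_ext {1..d} (g \<circ> ?e)"
    \<comment> \<open>Position \<open>0\<close> lies outside both index sets, so both words vanish
      there and the formula for \<open>?h\<close> extends to \<open>t = 0\<close>.\<close>
    have "g 0 = 0" using signed_arrs_outside[OF g, of 0] by (simp add: residue_class_def)
    then have h: "?h t = g (t * k)" if "t \<le> d" for t
      using that by (cases "t = 0") auto
    have "{i. i + k \<le> n \<and> i mod k = 0 \<and> g (i + k) < g i} = ?e ` {t. t + 1 \<le> d \<and> ?h (t + 1) < ?h t}"
    proof (intro equalityI subsetI)
      fix i assume i: "i \<in> {i. i + k \<le> n \<and> i mod k = 0 \<and> g (i + k) < g i}"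
      then have "i = i div k * k" by auto
      then obtain t where t: "i = t * k" by blast
      have k: "i + k = (t + 1) * k" by (simp add: t)
      from i have in_n: "i + k \<le> n" and desc: "g (i + k) < g i" by auto
      have td: "t + 1 \<le> d" using in_n le[of "t + 1"] unfolding k by blast
      have "?h (t + 1) < ?h t"
        using desc h[OF td] h[of t] td unfolding k unfolding t by simp
      then show "i \<in> ?e ` {t. t + 1 \<le> d \<and> ?h (t + 1) < ?h t}"
        using td t by blast
    next
      fix i assume "i \<in> ?e ` {t. t + 1 \<le> d \<and> ?h (t + 1) < ?h t}"
      then obtain t where t: "i = t * k" "t + 1 \<le> d" "?h (t + 1) < ?h t" by blast
      have k: "i + k = (t + 1) * k" by (simp add: t)
      have "i + k \<le> n" using t(2) le[of "t + 1"] unfolding k by blast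
      moreover have "g (i + k) < g i"
        using t(3) h[OF t(2)] h[of t] t(2) unfolding k unfolding t(1) by simp
      ultimately show "i \<in> {i. i + k \<le> n \<and> i mod k = 0 \<and> g (i + k) < g i}"
        using t(1) by simp
    qed
    moreover have "inj ?e" using r by (auto simp: inj_def)
    ultimately have "card {i. i + k \<le> n \<and> i mod k = 0 \<and> g (i + k) < g i} = gap_descents d 1 ?h"
      unfolding gap_descents_def by (simp only: card_image[OF inj_on_subset[OF _ subset_UNIV]])
    then show "residue_weight s n k 0 g = monom (s ^ neg_count {1..d} ?h) (gap_descents d 1 ?h)"
      by (simp only: residue_weight_def neg_count_zero_ext_comp[OF bij])
  qed
  also have "\<dots> = (\<Sum>h\<in>signed_arrs {1..d} V. monom (s ^ neg_count {1..d} h) (gap_descents d 1 h))"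
    by (rule sum_signed_arrs_reindex[OF bij])
  finally show ?thesis using sum_signed_arrs_gap_descents[OF V] by simp
qed

text \<open>No position precedes \<open>j\<close> in its class, as \<open>j < k\<close>; only
  comparisons inside the block occur, and the count is of type A with free signs.\<close>

lemma sum_residue_weight:
  fixes d r j :: nat
  defines "m \<equiv> if j \<le> r then d + 1 else d"
  assumes n: "n = d * k + r" and r: "r < k" and j: "0 < j" "j < k"
    and V: "V \<subseteq> {0<..}" "finite V" "card V = m"
  shows "(\<Sum>g\<in>signed_arrs (residue_class n k j) V. residue_weight s n k j g) =
    smult ((1 + s) ^ m) (eulerian_A m)"
proof -
  let ?e = "\<lambda>t. j + (t - 1) * k"
  let ?P = "residue_class n k j"
  have bij: "bij_betw ?e {1..m} ?P"
    using bij_betw_residue_class[OF n r j] by (simp only: m_def)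
  have le: "j + t * k \<le> n \<longleftrightarrow> t < m" for t
    using residue_add_mult_le_iff[of j k r t d] j r n by (simp only: m_def)
  have "(\<Sum>g\<in>signed_arrs ?P V. residue_weight s n k j g) =
    (\<Sum>g\<in>signed_arrs ?P V. monom (s ^ neg_count {1..m} (zero_ext {1..m} (g \<circ> ?e)))
       (card {t \<in> {1..<m}. zero_ext {1..m} (g \<circ> ?e) (t + 1) < zero_ext {1..m} (g \<circ> ?e) t}))"
  proof (rule sum.cong[OF refl])
    fix g assume g: "g \<in> signed_arrs ?P V"
    let ?h = "zero_ext {1..m} (g \<circ> ?e)"
    \<comment> \<open>The restriction to \<open>t \<ge> 1\<close> matters: by truncated subtraction
      \<open>?e 0\<close> and \<open>?e 1\<close> coincide.\<close>
    have e_Suc: "?e (t + 1) = ?e t + k" if "t \<ge> 1" for t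
      using that by (cases t) auto
    have h: "?h t = g (?e t)" "?h (t + 1) = g (?e t + k)" if "t \<in> {1..<m}" for t
    proof -
      have t: "t \<in> {1..m}" "t + 1 \<in> {1..m}" using that by auto
      show "?h t = g (?e t)" using t(1) by simp
      show "?h (t + 1) = g (?e t + k)"
        using zero_ext_apply(1)[OF t(2), of "g \<circ> ?e"] e_Suc[of t] that
        by (simp add: add.assoc)
    qed
    have "{i. i + k \<le> n \<and> i mod k = j \<and> g (i + k) < g i} = ?e ` {t \<in> {1..<m}. ?h (t + 1) < ?h t}"
    proof (intro equalityI subsetI)
      fix i assume "i \<in> {i. i + k \<le> n \<and> i mod k = j \<and> g (i + k) < g i}"
      then have i: "i + k \<le> n" "i mod k = j" "g (i + k) < g i" by auto
      let ?t = "i div k + 1"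
      have et: "?e ?t = i" using i(2) by auto
      have "j + ?t * k = i + k" using et by simp
      then have "?t \<in> {1..<m}" using le[of ?t] i(1) by simp
      moreover from this have "?h (?t + 1) < ?h ?t" using h[of ?t] i(3) unfolding et by simp
      ultimately show "i \<in> ?e ` {t \<in> {1..<m}. ?h (t + 1) < ?h t}"
        using et by (intro image_eqI[where x = ?t]) simp_all
    next
      fix i assume "i \<in> ?e ` {t \<in> {1..<m}. ?h (t + 1) < ?h t}"
      then obtain t where t: "i = ?e t" "t \<in> {1..<m}" "?h (t + 1) < ?h t" by blast
      have "i + k = j + t * k" using e_Suc[of t] t by simp
      then have "i + k \<le> n" using le[of t] t by simp
      moreover have "i mod k = j" using j t(1) by simp
      moreover have "g (i + k) < g i" using t(3) h[OF t(2)] unfolding t(1) by simp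
      ultimately show "i \<in> {i. i + k \<le> n \<and> i mod k = j \<and> g (i + k) < g i}" by simp
    qed
    moreover have "inj_on ?e {t \<in> {1..<m}. ?h (t + 1) < ?h t}"
      using bij by (auto simp: bij_betw_def simp del: One_nat_def intro: inj_on_subset)
    ultimately have "card {i. i + k \<le> n \<and> i mod k = j \<and> g (i + k) < g i} =
        card {t \<in> {1..<m}. ?h (t + 1) < ?h t}"
      by (simp only: card_image)
    then show "residue_weight s n k j g =
        monom (s ^ neg_count {1..m} ?h) (card {t \<in> {1..<m}. ?h (t + 1) < ?h t})"
      by (simp only: residue_weight_def neg_count_zero_ext_comp[OF bij])
  qed
  also have "\<dots> = (\<Sum>h\<in>signed_arrs {1..m} V.
      monom (s ^ neg_count {1..m} h) (card {t \<in> {1..<m}. h (t + 1) < h t}))"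
    by (rule sum_signed_arrs_reindex[OF bij])
  finally show ?thesis using sum_signed_arrs_descents[OF V] by simp
qed

section \<open>Assembly of the residue classes\<close>

lemma card_eq_sum_residues:
  fixes S :: "nat set"
  assumes "finite S" "0 < k"
  shows "card S = (\<Sum>j<k. card {i \<in> S. i mod k = j})"
proof -
  have "(\<lambda>i. i mod k) ` S \<subseteq> {..<k}" using assms(2) by auto
  from sum.group[OF assms(1) finite_lessThan this, of "\<lambda>_. 1 :: nat"]
  show ?thesis by (simp only: card_eq_sum)
qed

lemma prod_monom: "(\<Prod>j\<in>A. monom (c j) (e j)) = monom (\<Prod>j\<in>A. c j) (\<Sum>j\<in>A. e j)"
  by (induction A rule: infinite_finite_induct) (simp_all add: mult_monom)

text \<open>Positions \<open>i\<close> and \<open>i + k\<close> have the same residue, so each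
  comparison stays inside one class. Both statistics are then sums over the classes, and the
  monomial is a product.\<close>

lemma monom_gap_descents_eq_prod:
  fixes s :: rat
  assumes f: "f \<in> signed_arrs {1..n} V" and k: "0 < k"
  shows "monom (s ^ neg_count {1..n} f) (gap_descents n k f) =
    (\<Prod>j<k. residue_weight s n k j (zero_ext (residue_class n k j) f))"
proof -
  let ?z = "\<lambda>j. zero_ext (residue_class n k j) f"
  have "f 0 = 0" using signed_arrs_outside[OF f, of 0] by simp
  then have z: "?z j i = f i" if "i \<le> n" "i mod k = j" for i j
    using that by (cases "i = 0") (auto simp: zero_ext_def residue_class_def)
  have neg: "neg_count (residue_class n k j) (?z j) = card {i \<in> {i \<in> {1..n}. f i < 0}. i mod k = j}" for j
    unfolding neg_count_def by (rule arg_cong[of _ _ card]) (auto simp: residue_class_def)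
  have desc: "{i. i + k \<le> n \<and> i mod k = j \<and> ?z j (i + k) < ?z j i} =
      {i \<in> {i. i + k \<le> n \<and> f (i + k) < f i}. i mod k = j}" for j
    using z[of _ j] by auto
  have fin: "finite {i. i + k \<le> n \<and> f (i + k) < f i}"
    by (rule finite_subset[of _ "{..n}"]) auto
  have "(\<Prod>j<k. residue_weight s n k j (?z j)) =
    monom (s ^ (\<Sum>j<k. card {i \<in> {i \<in> {1..n}. f i < 0}. i mod k = j}))
      (\<Sum>j<k. card {i \<in> {i. i + k \<le> n \<and> f (i + k) < f i}. i mod k = j})"
    by (simp only: residue_weight_def neg desc prod_monom power_sum)
  also have "\<dots> = monom (s ^ neg_count {1..n} f) (gap_descents n k f)"
    using card_eq_sum_residues[OF fin k] card_eq_sum_residues[of "{i \<in> {1..n}. f i < 0}" k] k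
    by (simp only: gap_descents_def neg_count_def) simp
  finally show ?thesis ..
qed

lemma prod_split_at:
  fixes a b :: "'b::comm_monoid_mult"
  assumes "r < k"
  shows "(\<Prod>j<k. if j = 0 then c else if j \<le> r then a else b) = c * a ^ r * b ^ (k - r - 1)"
proof -
  have "{..<k} = insert 0 ({1..r} \<union> {r<..<k})" using assms by auto
  then have "(\<Prod>j<k. if j = 0 then c else if j \<le> r then a else b) =
      c * (\<Prod>j\<in>{1..r} \<union> {r<..<k}. if j = 0 then c else if j \<le> r then a else b)"
    by simp
  also have "\<dots> = c * ((\<Prod>j\<in>{1..r}. if j = 0 then c else if j \<le> r then a else b) *
      (\<Prod>j\<in>{r<..<k}. if j = 0 then c else if j \<le> r then a else b))"
    by (subst prod.union_disjoint) auto
  also have "(\<Prod>j\<in>{1..r}. if j = 0 then c else if j \<le> r then a else b) = (\<Prod>j\<in>{1..r}. a)"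
    by (rule prod.cong) auto
  also have "(\<Prod>j\<in>{r<..<k}. if j = 0 then c else if j \<le> r then a else b) = (\<Prod>j\<in>{r<..<k}. b)"
    by (rule prod.cong) auto
  finally show ?thesis by (simp add: mult_ac)
qed

text \<open>The class of \<open>0\<close> has \<open>d\<close> positions, the classes
  \<open>1, ..., r\<close> have \<open>d + 1\<close>, and the other \<open>k - r - 1\<close> have
  \<open>d\<close>. These sizes determine both the factorials and the powers of the block
  contributions.\<close>

lemma sum_signed_arrs_gap:
  fixes s :: rat
  assumes n: "n = d * k + r" and r: "r < k"
  shows "(\<Sum>f\<in>signed_arrs {1..n} {1..int n}. monom (s ^ neg_count {1..n} f) (gap_descents n k f)) =
    smult (multi_coeff n k * ((1 + s) ^ (d + 1)) ^ r * ((1 + s) ^ d) ^ (k - r - 1))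
      (eulerian_B_signed s d * eulerian_A d ^ (k - r - 1) * eulerian_A (d + 1) ^ r)"
proof -
  let ?P = "residue_class n k"
  let ?A = "\<lambda>m. smult ((1 + s) ^ m) (eulerian_A m)"
  define c where "c j = (if j = 0 then eulerian_B_signed s d else if j \<le> r then ?A (d + 1) else ?A d)" for j
  have cardP: "card (?P j) = (if j = 0 then d else if j \<le> r then d + 1 else d)" if "j < k" for j
    using bij_betw_same_card[OF bij_betw_residue_class_0[OF n r]]
      bij_betw_same_card[OF bij_betw_residue_class[OF n r _ that]] by (cases "j = 0") auto
  have UN: "(\<Union>j<k. ?P j) = {1..n}" using r by (auto simp: residue_class_def)
  have finP: "finite (?P j)" for j by (simp add: residue_class_def)
  have "(\<Sum>f\<in>signed_arrs {1..n} {1..int n}. monom (s ^ neg_count {1..n} f) (gap_descents n k f)) =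
    (\<Sum>f\<in>signed_arrs (\<Union>j\<in>{..<k}. ?P j) {1..int n}. \<Prod>j\<in>{..<k}. residue_weight s n k j (zero_ext (?P j) f))"
    unfolding UN using r by (intro sum.cong refl monom_gap_descents_eq_prod) auto
  also have "\<dots> = smult (fact (card {1..int n}) / (\<Prod>j\<in>{..<k}. fact (card (?P j)))) (\<Prod>j\<in>{..<k}. c j)"
  proof (rule sum_signed_arrs_UNION)
    show "disjoint_family_on ?P {..<k}"
      by (auto simp: disjoint_family_on_def residue_class_def)
    show "(\<Sum>f\<in>signed_arrs (?P j) U. residue_weight s n k j f) = c j"
      if "j \<in> {..<k}" "U \<subseteq> {0<..}" "finite U" "card U = card (?P j)" for j U
    proof (cases "j = 0")
      case True
      then show ?thesis using that cardP[of j] sum_residue_weight_0[OF n r that(2,3)] by (simp add: c_def)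
    next
      case False
      then show ?thesis
        using that cardP[of j] sum_residue_weight[OF n r _ _ that(2,3), of j] by (simp add: c_def)
    qed
    have "(\<Sum>j<k. card (?P j)) = card {1..n}"
      using card_eq_sum_residues[of "{1..n}" k] r by (simp add: residue_class_def)
    then show "card {1..int n} = (\<Sum>j\<in>{..<k}. card (?P j))" by simp
  qed (use finP in auto)
  also have "(\<Prod>j<k. c j) = eulerian_B_signed s d * ?A (d + 1) ^ r * ?A d ^ (k - r - 1)"
    unfolding c_def by (rule prod_split_at[OF r])
  also have "(\<Prod>j<k. fact (card (?P j)) :: rat) =
      (\<Prod>j<k. if j = 0 then fact d else if j \<le> r then fact (d + 1) else fact d)"
    using cardP by (intro prod.cong refl) auto
  also have "\<dots> = fact d * fact (d + 1) ^ r * fact d ^ (k - r - 1)"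
    by (rule prod_split_at[OF r])
  \<comment> \<open>The factor \<open>fact d\<close> of the class of \<open>0\<close> joins those of
    the \<open>k - r - 1\<close> classes of size \<open>d\<close>, giving the exponent
    \<open>k - r\<close>.\<close>
  also have "fact (card {1..int n}) / \<dots> = (multi_coeff n k :: rat)"
  proof -
    have "n div k = d" "n mod k = r" using n r by auto
    moreover have "k - r = Suc (k - r - 1)" using r by simp
    then have "(fact d :: rat) ^ (k - r) = fact d * fact d ^ (k - r - 1)" by (metis power_Suc)
    ultimately show ?thesis by (simp add: multi_coeff_def Let_def mult_ac)
  qed
  finally show ?thesis by (simp add: smult_power mult_ac)
qed

section \<open>Passage to the even signed permutations\<close>

text \<open>Adding the powers of \<open>1\<close> and \<open>-1\<close> with the same exponent gives
  \<open>2\<close> for an even exponent and \<open>0\<close> for an odd one, which selects the even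
  signed permutations.\<close>

lemma two_WD_eq:
  assumes "1 \<le> k"
  shows "smult 2 (WD n k) = (\<Sum>s\<in>{1, -1}. \<Sum>f\<in>signed_arrs {1..n} {1..int n}.
    monom (s ^ neg_count {1..n} f) (gap_descents n k f))"
proof -
  let ?N = "\<lambda>\<pi>. card {i \<in> {1..int n}. \<pi> i < 0}"
  have T: "(\<Sum>f\<in>signed_arrs {1..n} {1..int n}. monom (s ^ neg_count {1..n} f) (gap_descents n k f)) =
     (\<Sum>\<pi>\<in>signed_perms n. monom (s ^ ?N \<pi>) (des_B n k \<pi>))" for s :: rat
  proof -
    have "(\<Sum>\<pi>\<in>signed_perms n. monom (s ^ ?N \<pi>) (des_B n k \<pi>)) =
      (\<Sum>\<pi>\<in>signed_perms n. monom (s ^ neg_count {1..n} (zero_ext {1..n} (\<lambda>i. \<pi> (int i))))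
        (gap_descents n k (zero_ext {1..n} (\<lambda>i. \<pi> (int i)))))"
    proof (rule sum.cong[OF refl])
      fix \<pi> assume \<pi>: "\<pi> \<in> signed_perms n"
      show "monom (s ^ ?N \<pi>) (des_B n k \<pi>) =
          monom (s ^ neg_count {1..n} (zero_ext {1..n} (\<lambda>i. \<pi> (int i))))
            (gap_descents n k (zero_ext {1..n} (\<lambda>i. \<pi> (int i))))"
        unfolding neg_card_eq_neg_count[of n \<pi>] des_B_eq_gap_descents[OF \<pi> assms] ..
    qed
    also have "\<dots> = (\<Sum>f\<in>signed_arrs {1..n} {1..int n}.
        monom (s ^ neg_count {1..n} f) (gap_descents n k f))"
      by (rule sum_signed_perms)
    finally show ?thesis ..
  qed
  have "smult 2 (WD n k) = (\<Sum>\<pi>\<in>signed_perms n. if even (?N \<pi>) then monom 2 (des_B n k \<pi>) else 0)"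
    unfolding WD_def even_signed_perms_def des_D_def smult_sum_right
    by (subst sum.inter_filter[OF finite_signed_perms]) (auto intro!: sum.cong simp: smult_monom)
  also have "\<dots> = (\<Sum>\<pi>\<in>signed_perms n. \<Sum>s\<in>{1, -1}. monom (s ^ ?N \<pi>) (des_B n k \<pi>))"
    by (intro sum.cong refl) (auto simp: add_monom)
  also have "\<dots> = (\<Sum>s\<in>{1, -1}. \<Sum>\<pi>\<in>signed_perms n. monom (s ^ ?N \<pi>) (des_B n k \<pi>))"
    by (rule sum.swap)
  finally show ?thesis unfolding T .
qed

theorem theorem24:
  fixes n k d r :: nat
  assumes "n \<ge> 1"
  shows "(k = 1 \<longrightarrow> WD n k = eulerian_D n) \<and>
    (2 \<le> k \<and> k \<le> n \<and> n = d * k + r \<and> r < k \<longrightarrow>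
       WD n k = smult (2 ^ (n - d - 1) * multi_coeff n k)
         (eulerian_B d * eulerian_A d ^ (k - r - 1) * eulerian_A (d + 1) ^ r))"
proof (intro conjI impI)
  assume "k = 1"
  then show "WD n k = eulerian_D n" by (simp add: WD_def eulerian_D_def des_D_def)
next
  assume "2 \<le> k \<and> k \<le> n \<and> n = d * k + r \<and> r < k"
  then have k: "2 \<le> k" "k \<le> n" and n: "n = d * k + r" and r: "r < k" by auto
  let ?E = "eulerian_B d * eulerian_A d ^ (k - r - 1) * eulerian_A (d + 1) ^ r"
  have d: "d \<ge> 1" using k n r by (cases d) auto
  \<comment> \<open>As \<open>0 ^ 0 = 1\<close>, a positive exponent is required: for
    \<open>r > 0\<close> the first factor vanishes, and for \<open>r = 0\<close> the second does,
    because \<open>k - 1 \<ge> 1\<close> and \<open>d \<ge> 1\<close>.\<close>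
  have "((1 + - 1 :: rat) ^ (d + 1)) ^ r * ((1 + - 1) ^ d) ^ (k - r - 1) = 0"
    using d k by (cases "r = 0") (auto simp: power_0_left)
  then have zero: "multi_coeff n k * ((1 + - 1) ^ (d + 1)) ^ r * ((1 + - 1) ^ d) ^ (k - r - 1) = 0"
    by (simp only: mult.assoc mult_zero_right)
  have two: "(\<Sum>s\<in>{1, -1}. F s) = F 1 + F (- 1)" for F :: "rat \<Rightarrow> rat poly" by simp
  have "1 \<le> k" using k by simp
  then have "smult 2 (WD n k) =
      smult (multi_coeff n k * ((1 + 1) ^ (d + 1)) ^ r * ((1 + 1) ^ d) ^ (k - r - 1)) ?E"
    by (simp only: two_WD_eq sum_signed_arrs_gap[OF n r] two zero eulerian_B_signed_1
        smult_0_left add_0_right)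
  also have "multi_coeff n k * ((1 + 1) ^ (d + 1)) ^ r * ((1 + 1) ^ d) ^ (k - r - 1) =
      2 * (2 ^ (n - d - 1) * multi_coeff n k)"
  proof -
    \<comment> \<open>\<open>q\<close> is the number of nonzero classes of size \<open>d\<close>.
      The exponent of \<open>2\<close> counts the positions outside the class of \<open>0\<close>,
      namely \<open>n - d\<close>; halving lowers it by one.\<close>
    obtain q where q: "k = Suc (r + q)" using r less_iff_Suc_add by blast
    \<comment> \<open>Positivity ensures that the truncated subtraction \<open>n - d - 1\<close> is
      a true one.\<close>
    have "0 < d * (r + q)" using d k q by (intro mult_pos_pos) linarith+
    moreover have "n = d + (r + d * (r + q))" by (simp add: n q)
    ultimately have "Suc (n - d - 1) = r + d * (r + q)" by simp
    then have "(d + 1) * r + d * q = Suc (n - d - 1)" by (simp add: algebra_simps)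
    then have "(2::rat) ^ ((d + 1) * r + d * q) = 2 * 2 ^ (n - d - 1)" by (simp only: power_Suc)
    then show ?thesis by (simp add: q power_add power_mult mult_ac)
  qed
  finally have "smult (1 / 2) (smult 2 (WD n k)) =
      smult (1 / 2) (smult (2 * (2 ^ (n - d - 1) * multi_coeff n k)) ?E)" by simp
  then show "WD n k = smult (2 ^ (n - d - 1) * multi_coeff n k) ?E" by simp
qed

end
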